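(* Let $C_{\mathrm{Mersenne}}$ be the set of all residues $M_\rho \bmod 360$ (taken in $\{0,1,\dots,359\}$), where $M_\rho = 2^\rho-1$ runs over all Mersenne primes. Then $$C_{\mathrm{Mersenne}}=\{3, 7, 31, 127, 247, 271\}.$$
   Context: A Mersenne prime is a prime number of the form $M_\rho = 2^{\rho}-1$ with $\rho$ a prime number. The ova-angular residue of a prime $p$ is $\daleth_p = p-360\lfloor p/360\rfloor$, the remainder of $p$ on division by $360$; thus $C_{\mathrm{Mersenne}}$ is the set of ova-angular residues of the Mersenne primes. *)

theory Defs
  imports Complex_Main "HOL-Computational_Algebra.Primes"
begin

definition mersenne_number :: "nat \<Rightarrow> nat" where
  "mersenne_number \<rho> = 2 ^ \<rho> - 1"

definition mersenne_prime :: "nat \<Rightarrow> bool" where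
  "mersenne_prime p \<longleftrightarrow> prime p \<and> (\<exists>\<rho>. prime \<rho> \<and> p = mersenne_number \<rho>)"

definition ova_angular_residue :: "nat \<Rightarrow> int" where
  "ova_angular_residue p = int p - 360 * \<lfloor>real p / 360\<rfloor>"

lemma ova_angular_residue_eq_mod: "ova_angular_residue p = int p mod 360"
proof -
  have "\<lfloor>real p / 360\<rfloor> = int p div 360"
    using floor_divide_of_nat_eq[of p 360, where ?'a = real] by (simp add: zdiv_int)
  then show ?thesis
    by (simp add: ova_angular_residue_def minus_mult_div_eq_mod)
qed

definition C_Mersenne :: "int set" where
  "C_Mersenne = {ova_angular_residue p | p. mersenne_prime p}"

end

theory Submission
  imports Defs "HOL-Number_Theory.Pocklington"
begin

text \<open>
  Modulo 360 the powers of 2 from \<open>2 ^ 3\<close> on are periodic with period 12, because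
  \<open>2 ^ 3 * (2 ^ 12 - 1) = 91 * 360\<close>. A prime exponent larger than 3 is coprime to 12, so
  it is congruent to 1, 5, 7 or 11 modulo 12, and these four classes give the residues 271, 31, 127
  and 247 of \<open>2 ^ \<rho> - 1\<close>; the exponents 2 and 3 contribute 3 and 7. That bounds the set from
  above.

  Conversely every one of these residues has to be attained by an actual Mersenne prime. The
  exponents 2, 3, 5, 7 and 13 give small primes. The remaining class, 11 modulo 12, is the
  expensive one: the numbers with exponents 11, 23, 47, 59, 71 and 83 are all composite, and the
  least exponent in the class that yields a prime is 107. The primality of \<open>2 ^ 107 - 1\<close> follows
  from the Lucas--Lehmer test: with \<open>s 0 = 4\<close> and \<open>s (k + 1) = (s k)\<^sup>2 - 2\<close>, it suffices that
  \<open>2 ^ p - 1\<close> divides \<open>s (p - 2)\<close>. The reason is that \<open>s k\<close> is the trace of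
  \<open>(2 + \<surd>3) ^ (2 ^ k)\<close>; the vanishing of \<open>s (p - 2)\<close> modulo a prime divisor \<open>q\<close> forces
  \<open>2 + \<surd>3\<close> to have order \<open>2 ^ p\<close> modulo \<open>q\<close>, which leaves no room for
  \<open>q\<^sup>2 < 2 ^ p\<close>. For \<open>p = 107\<close> the test takes 105 squarings of numbers of about 107 bits,
  which rewriting with binary numerals can carry out.
\<close>

section \<open>Residues of powers of two modulo 360\<close>

lemma power_two_mod_360_periodic:
  assumes "3 \<le> k"
  shows "(2::nat) ^ (12 * m + k) mod 360 = 2 ^ k mod 360"
proof (induction m)
  case 0
  show ?case by simp
next
  case (Suc m)
  obtain j where j: "12 * m + k = 3 + j"
    using assms le_Suc_ex[of 3 "12 * m + k"] by auto
  have "(2::nat) ^ (12 * Suc m + k) = 2 ^ 12 * 2 ^ (12 * m + k)"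
    by (simp add: power_add)
  also have "\<dots> = 2 ^ (12 * m + k) + 360 * (91 * 2 ^ j)"
    unfolding j by (simp add: power_add)
  finally show ?case
    using Suc.IH by (simp only: mod_mult_self2)
qed

text \<open>
  The class of 1 modulo 12 is represented by 13 rather than 1, since the exponent 1 lies before
  the periodic range.
\<close>
lemma prime_gt_3_decompose_mod_12:
  fixes p :: nat
  assumes "prime p" "3 < p"
  obtains m k where "p = 12 * m + k" "k \<in> {5, 7, 11, 13}"
proof -
  have "\<not> 2 dvd p" "\<not> 3 dvd p"
    using assms by (auto simp: prime_nat_iff)
  then have "p mod 12 \<in> {1, 5, 7, 11}"
    by (simp only: insert_iff empty_iff) presburger
  then consider "p mod 12 \<in> {5, 7, 11}" | "p mod 12 = 1" by auto
  then show thesis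
  proof cases
    case 1
    then show thesis
      using that[of "p div 12" "p mod 12"] by auto
  next
    case 2
    then have "p = 12 * (p div 12 - 1) + 13"
      using assms(2) by presburger
    then show thesis
      using that by blast
  qed
qed

lemma power_two_prime_mod_360:
  fixes p :: nat
  assumes "prime p"
  shows "2 ^ p mod 360 \<in> {4, 8, 32, 128, 248, 272::nat}"
proof (cases "3 < p")
  case True
  then obtain m k where "p = 12 * m + k" "k \<in> {5, 7, 11, 13}"
    using prime_gt_3_decompose_mod_12 assms by blast
  then show ?thesis
    by (auto simp: power_two_mod_360_periodic)
next
  case False
  then have "p = 2 \<or> p = 3"
    using prime_ge_2_nat[OF assms] by auto
  then show ?thesis by auto
qed

section \<open>The Lucas--Lehmer test\<close>

text \<open>
  The coordinates of the powers of the unit \<open>\<omega> = 2 + \<surd>3\<close>, that is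
  \<open>\<omega> ^ n = lucas_u n + lucas_v n * \<surd>3\<close>. Keeping the two integer coordinates apart makes it possible
  to reduce them modulo a prime without constructing the quotient ring of \<open>\<int>[\<surd>3]\<close>.
\<close>
fun lucas_u :: "nat \<Rightarrow> int" and lucas_v :: "nat \<Rightarrow> int" where
  "lucas_u 0 = 1"
| "lucas_v 0 = 0"
| "lucas_u (Suc n) = 2 * lucas_u n + 3 * lucas_v n"
| "lucas_v (Suc n) = lucas_u n + 2 * lucas_v n"

lemma lucas_add:
  "lucas_u (m + n) = lucas_u m * lucas_u n + 3 * lucas_v m * lucas_v n"
  "lucas_v (m + n) = lucas_u m * lucas_v n + lucas_v m * lucas_u n"
  by (induction m) (simp_all add: algebra_simps)

text \<open>The norm of \<open>\<omega>\<close> is \<open>2\<^sup>2 - 3 * 1\<^sup>2 = 1\<close>, and norms are multiplicative.\<close>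
lemma lucas_norm: "(lucas_u n)\<^sup>2 - 3 * (lucas_v n)\<^sup>2 = 1"
proof (induction n)
  case (Suc n)
  have "(lucas_u (Suc n))\<^sup>2 - 3 * (lucas_v (Suc n))\<^sup>2 = (lucas_u n)\<^sup>2 - 3 * (lucas_v n)\<^sup>2"
    by (simp add: power2_eq_square algebra_simps)
  with Suc.IH show ?case by simp
qed simp

lemma lucas_double:
  "lucas_u (2 * n) = 2 * (lucas_u n)\<^sup>2 - 1"
  "lucas_v (2 * n) = 2 * lucas_u n * lucas_v n"
  using lucas_norm[of n] unfolding mult_2[of n] lucas_add
  by (simp_all add: power2_eq_square)

primrec lucas_lehmer :: "nat \<Rightarrow> int" where
  "lucas_lehmer 0 = 4"
| "lucas_lehmer (Suc k) = (lucas_lehmer k)\<^sup>2 - 2"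

text \<open>
  Since \<open>lucas_u (2 * n) = 2 * (lucas_u n)\<^sup>2 - 1\<close>, doubling the exponent of \<open>\<omega>\<close> acts on the trace
  \<open>2 * lucas_u n\<close> as \<open>s \<mapsto> s\<^sup>2 - 2\<close>.
\<close>
lemma lucas_lehmer_eq_lucas_u: "lucas_lehmer k = 2 * lucas_u (2 ^ k)"
proof (induction k)
  case 0
  show ?case by (simp add: numeral_eq_Suc)
next
  case (Suc k)
  then show ?case
    by (simp add: lucas_double power_mult_distrib)
qed

text \<open>The relation \<open>\<omega> ^ d = 1\<close> in \<open>\<int>[\<surd>3]\<close> modulo \<open>q\<close>.\<close>
definition unit_power_cong_one :: "int \<Rightarrow> nat \<Rightarrow> bool" where
  "unit_power_cong_one q d \<longleftrightarrow> [lucas_u d = 1] (mod q) \<and> [lucas_v d = 0] (mod q)"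

lemma unit_power_cong_one_add:
  assumes "unit_power_cong_one q d"
  shows "[lucas_u (d + n) = lucas_u n] (mod q)"
proof -
  have "[lucas_u d * lucas_u n + lucas_v d * (3 * lucas_v n) = 1 * lucas_u n + 0 * (3 * lucas_v n)] (mod q)"
    using assms unfolding unit_power_cong_one_def by (intro cong_add cong_mult cong_refl) simp_all
  then show ?thesis
    by (simp add: lucas_add mult_ac)
qed

lemma unit_power_cong_one_mult:
  assumes "unit_power_cong_one q d"
  shows "unit_power_cong_one q (d * m)"
proof (induction m)
  case 0
  show ?case by (simp add: unit_power_cong_one_def)
next
  case (Suc m)
  have "[lucas_u d * lucas_v (d * m) + lucas_v d * lucas_u (d * m) = 1 * 0 + 0 * lucas_u (d * m)] (mod q)"
    using assms Suc.IH unfolding unit_power_cong_one_def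
    by (intro cong_add cong_mult cong_refl) simp_all
  then show ?case
    using Suc.IH unit_power_cong_one_add[OF assms, of "d * m"]
    by (auto simp: unit_power_cong_one_def lucas_add(2) intro: cong_trans)
qed

text \<open>
  Powers of \<open>\<omega>\<close> can be cancelled because the norm is 1: the inverse of \<open>\<omega> ^ i\<close> is its conjugate
  \<open>lucas_u i - lucas_v i * \<surd>3\<close>, so \<open>\<omega> ^ (j - i)\<close> is the product of \<open>\<omega> ^ j\<close> with that conjugate.
\<close>
lemma unit_power_cong_one_diff:
  assumes "i \<le> j"
    and u: "[lucas_u i = lucas_u j] (mod q)" and v: "[lucas_v i = lucas_v j] (mod q)"
  shows "unit_power_cong_one q (j - i)"
proof -
  define d where "d = j - i"
  have j: "j = d + i" using assms(1) by (simp add: d_def)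
  have n: "lucas_u i * lucas_u i = 1 + 3 * (lucas_v i * lucas_v i)"
    using lucas_norm[of i] by (simp add: power2_eq_square)
  have "lucas_u j * lucas_u i - 3 * lucas_v j * lucas_v i
      = lucas_u d * (lucas_u i * lucas_u i - 3 * (lucas_v i * lucas_v i))"
    unfolding j lucas_add by (simp add: algebra_simps)
  then have ud: "lucas_u j * lucas_u i - 3 * lucas_v j * lucas_v i = lucas_u d"
    by (simp add: n)
  have "lucas_v j * lucas_u i - lucas_u j * lucas_v i
      = lucas_v d * (lucas_u i * lucas_u i - 3 * (lucas_v i * lucas_v i))"
    unfolding j lucas_add by (simp add: algebra_simps)
  then have vd: "lucas_v j * lucas_u i - lucas_u j * lucas_v i = lucas_v d"
    by (simp add: n)
  have "[lucas_u i * lucas_u i - 3 * lucas_v i * lucas_v i = lucas_u d] (mod q)"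
    unfolding ud[symmetric] using u v by (intro cong_diff cong_mult cong_refl)
  moreover have "[lucas_v i * lucas_u i - lucas_u i * lucas_v i = lucas_v d] (mod q)"
    unfolding vd[symmetric] using u v by (intro cong_diff cong_mult cong_refl)
  moreover have "lucas_u i * lucas_u i - 3 * lucas_v i * lucas_v i = 1"
      "lucas_v i * lucas_u i - lucas_u i * lucas_v i = 0"
    using n by simp_all
  ultimately show ?thesis
    unfolding unit_power_cong_one_def d_def[symmetric] by (metis cong_sym)
qed

text \<open>
  The sufficiency of the Lucas--Lehmer test. If \<open>2 ^ p - 1\<close> were composite, it would have a prime
  divisor \<open>q\<close> with \<open>q\<^sup>2 \<le> 2 ^ p - 1\<close>. Modulo \<open>q\<close> the hypothesis says that the
  trace of \<open>\<omega> ^ (2 ^ (p - 2))\<close> vanishes, hence \<open>\<omega> ^ (2 ^ (p - 1)) = - 1\<close> and the order of \<open>\<omega>\<close>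
  is exactly \<open>2 ^ p\<close>. So \<open>\<omega>\<close> has \<open>2 ^ p\<close> distinct powers, more than the \<open>q\<^sup>2\<close> pairs
  of coordinates that are available modulo \<open>q\<close>.
\<close>
theorem lucas_lehmer_imp_prime:
  assumes "2 \<le> p" and dvd: "2 ^ p - 1 dvd lucas_lehmer (p - 2)"
  shows "prime (2 ^ p - 1 :: nat)"
proof (rule ccontr)
  have "(2::nat) ^ 2 \<le> 2 ^ p"
    using \<open>2 \<le> p\<close> by (intro power_increasing) auto
  then have p4: "(4::nat) \<le> 2 ^ p" by simp
  assume "\<not> prime (2 ^ p - 1 :: nat)"
  moreover have "(2::nat) ^ p - 1 \<noteq> 0" "(2::nat) ^ p - 1 \<noteq> 1"
    using p4 by linarith+
  ultimately obtain q :: nat where q: "prime q" "q dvd 2 ^ p - 1" "q\<^sup>2 \<le> 2 ^ p - 1"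
    unfolding prime_prime_factor_sqrt[of "2 ^ p - 1"] by blast
  have "odd (2 ^ p - 1 :: nat)"
    using p4 \<open>2 \<le> p\<close> by auto
  then have "odd q"
    using q(2) dvd_trans by blast
  then have "2 < q"
    using prime_ge_2_nat[OF q(1)] by (cases "q = 2") auto
  define n where "n = (2::nat) ^ (p - 2)"
  obtain k where "p = k + 2"
    using \<open>2 \<le> p\<close> by (metis add.commute le_Suc_ex)
  then have n: "2 ^ (p - 1) = 2 * n"
    by (simp add: n_def)
  have "int q dvd int (2 ^ p - 1)"
    using q(2) by (simp only: int_dvd_int_iff)
  also have "int (2 ^ p - 1) = 2 ^ p - 1"
    using p4 by simp
  finally have "int q dvd 2 * lucas_u n"
    using dvd dvd_trans unfolding lucas_lehmer_eq_lucas_u n_def by blast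
  then have qu: "int q dvd lucas_u n"
    using q(1) \<open>2 < q\<close> by (auto simp: prime_dvd_mult_iff dest: zdvd_imp_le)
  have half: "[lucas_u (2 * n) = - 1] (mod q)" "[lucas_v (2 * n) = 0] (mod q)"
    using qu by (simp_all add: lucas_double cong_iff_dvd_diff power2_eq_square)
  have full: "unit_power_cong_one q (4 * n)"
  proof -
    have "[2 * (lucas_u (2 * n))\<^sup>2 - 1 = 2 * (- 1)\<^sup>2 - 1] (mod q)"
      using half(1) by (intro cong_diff cong_mult cong_pow cong_refl)
    moreover have "[2 * lucas_u (2 * n) * lucas_v (2 * n) = 2 * lucas_u (2 * n) * 0] (mod q)"
      using half(2) by (intro cong_mult cong_refl)
    ultimately show ?thesis
      using lucas_double[of "2 * n"] by (simp add: unit_power_cong_one_def)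
  qed
  have not_one: "\<not> unit_power_cong_one q d" if "0 < d" "d < 2 ^ p" for d
  proof
    assume d: "unit_power_cong_one q d"
    \<comment> \<open>Raising \<open>\<omega> ^ d = 1\<close> to a power of two turns \<open>d\<close> into an odd multiple of \<open>2 ^ (p - 1)\<close>, at which
      the value is \<open>- 1\<close>.\<close>
    obtain t c where c: "d = 2 ^ t * c" "odd c"
      using \<open>0 < d\<close> by (metis multiplicity_decompose' not_gr_zero two_is_prime_nat not_prime_unit)
    have "2 ^ t \<le> d"
      using c \<open>0 < d\<close> by simp
    then have "(2::nat) ^ t < 2 ^ p"
      using \<open>d < 2 ^ p\<close> by linarith
    then have "t < p" by simp
    then have "t + (p - 1 - t) = p - 1" by simp
    then have "d * 2 ^ (p - 1 - t) = 2 ^ (p - 1) * c"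
      by (simp add: c(1) mult_ac flip: power_add)
    also have "\<dots> = 4 * n * (c div 2) + 2 * n"
      unfolding n using \<open>odd c\<close> by (elim oddE) (simp add: algebra_simps)
    finally have "unit_power_cong_one q (4 * n * (c div 2) + 2 * n)"
      using unit_power_cong_one_mult[OF d, of "2 ^ (p - 1 - t)"] by simp
    then have "[1 = lucas_u (2 * n)] (mod q)"
      using unit_power_cong_one_add[OF unit_power_cong_one_mult[OF full, of "c div 2"], of "2 * n"]
      unfolding unit_power_cong_one_def by (blast intro: cong_sym cong_trans)
    then have "[1 = - 1] (mod int q)"
      using half(1) by (rule cong_trans)
    then have "int q dvd 2"
      by (simp add: cong_iff_dvd_diff)
    then show False
      using \<open>2 < q\<close> by (auto dest: zdvd_imp_le)
  qed
  define f where "f k = (lucas_u k mod q, lucas_v k mod q)" for k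
  have "inj_on f {..<2 ^ p}"
  proof (rule linorder_inj_onI)
    fix i j :: nat assume "i < j" "i \<in> {..<2 ^ p}" "j \<in> {..<2 ^ p}"
    then show "f i \<noteq> f j"
      using unit_power_cong_one_diff[of i j q] not_one[of "j - i"]
      by (auto simp: f_def cong_def)
  qed auto
  moreover have "f ` {..<2 ^ p} \<subseteq> {0..<int q} \<times> {0..<int q}"
    using \<open>2 < q\<close> by (auto simp: f_def)
  ultimately have "card {..<(2::nat) ^ p} \<le> card ({0..<int q} \<times> {0..<int q})"
    by (intro card_inj_on_le) auto
  then have "2 ^ p \<le> q\<^sup>2"
    by (simp add: card_cartesian_product power2_eq_square)
  then show False
    using q(3) p4 by simp
qed

section \<open>Evaluation of the test by folding bits\<close>

text \<open>
  Writing \<open>y = h * 2 ^ p + l\<close>, this is \<open>h + l\<close>: since \<open>2 ^ p\<close> is 1 modulo \<open>2 ^ p - 1\<close>, the high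
  bits may be added onto the low ones. On binary numerals this costs two shifts, an addition and a
  subtraction, whereas rewriting a general remainder takes a long division. The result is only
  congruent to \<open>y\<close>, not fully reduced.
\<close>
definition mersenne_fold :: "nat \<Rightarrow> int \<Rightarrow> int" where
  "mersenne_fold p y = y + drop_bit p y - push_bit p (drop_bit p y)"

lemma cong_mersenne_fold: "[mersenne_fold p y = y] (mod 2 ^ p - 1)"
proof -
  have "y - mersenne_fold p y = (2 ^ p - 1) * drop_bit p y"
    by (simp add: mersenne_fold_def push_bit_eq_mult algebra_simps)
  then show ?thesis
    by (simp add: cong_iff_dvd_diff dvd_diff_commute)
qed

text \<open>
  Two folds are needed per squaring: after a single one the overflow beyond \<open>p\<close> bits would double
  at every step, while the second fold brings the term back to about \<open>p\<close> bits.
\<close>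
primrec folded_lucas_lehmer :: "nat \<Rightarrow> nat \<Rightarrow> int" where
  "folded_lucas_lehmer p 0 = 4"
| "folded_lucas_lehmer p (Suc k) =
    mersenne_fold p (mersenne_fold p ((folded_lucas_lehmer p k)\<^sup>2 - 2))"

lemma cong_folded_lucas_lehmer:
  "[folded_lucas_lehmer p k = lucas_lehmer k] (mod 2 ^ p - 1)"
proof (induction k)
  case (Suc k)
  then have "[(folded_lucas_lehmer p k)\<^sup>2 - 2 = (lucas_lehmer k)\<^sup>2 - 2] (mod 2 ^ p - 1)"
    by (intro cong_diff cong_pow cong_refl)
  then show ?case
    using cong_mersenne_fold cong_trans
    unfolding folded_lucas_lehmer.simps lucas_lehmer.simps by blast
qed simp

text \<open>
  Rewrite rules for evaluating the test. The argument of the fold has to be a numeral, so that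
  the previous term of the sequence is computed once before it is duplicated by the unfolding.
\<close>
lemma folded_lucas_lehmer_numeral:
  "folded_lucas_lehmer p (numeral k) =
    mersenne_fold p (mersenne_fold p ((folded_lucas_lehmer p (pred_numeral k))\<^sup>2 - 2))"
  by (simp add: numeral_eq_Suc)

lemma mersenne_fold_numeral:
  "mersenne_fold p (numeral y) =
    numeral y + drop_bit p (numeral y) - push_bit p (drop_bit p (numeral y))"
  by (rule mersenne_fold_def)

lemma prime_mersenne_numberI:
  assumes "2 \<le> p" "2 ^ p - 1 dvd folded_lucas_lehmer p (p - 2)"
  shows "prime (mersenne_number p)"
  unfolding mersenne_number_def
  using assms lucas_lehmer_imp_prime cong_dvd_iff[OF cong_folded_lucas_lehmer] by blast

lemma prime_mersenne_13: "prime (mersenne_number 13)"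
  by (rule prime_mersenne_numberI)
    (simp_all add: folded_lucas_lehmer_numeral mersenne_fold_numeral)

lemma prime_mersenne_107: "prime (mersenne_number 107)"
  by (rule prime_mersenne_numberI)
    (simp_all add: folded_lucas_lehmer_numeral mersenne_fold_numeral)

section \<open>The set of residues\<close>

lemma ova_angular_residue_mersenne_number:
  "ova_angular_residue (mersenne_number \<rho>) = (int (2 ^ \<rho> mod 360) - 1) mod 360"
  by (simp add: ova_angular_residue_eq_mod mersenne_number_def zmod_int mod_diff_left_eq)

theorem theorem13:
  shows "C_Mersenne = {3, 7, 31, 127, 247, 271}"
proof
  show "C_Mersenne \<subseteq> {3, 7, 31, 127, 247, 271}"
  proof
    fix x assume "x \<in> C_Mersenne"
    then obtain \<rho> where "prime \<rho>" and x: "x = ova_angular_residue (mersenne_number \<rho>)"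
      by (auto simp: C_Mersenne_def mersenne_prime_def)
    from power_two_prime_mod_360[OF \<open>prime \<rho>\<close>] show "x \<in> {3, 7, 31, 127, 247, 271}"
      unfolding x ova_angular_residue_mersenne_number by auto
  qed
next
  have attained: "ova_angular_residue (mersenne_number \<rho>) \<in> C_Mersenne"
    if "prime \<rho>" "prime (mersenne_number \<rho>)" for \<rho>
    using that by (auto simp: C_Mersenne_def mersenne_prime_def)
  have residues:
    "ova_angular_residue (mersenne_number 2) = 3"
    "ova_angular_residue (mersenne_number 3) = 7"
    "ova_angular_residue (mersenne_number 5) = 31"
    "ova_angular_residue (mersenne_number 7) = 127"
    "ova_angular_residue (mersenne_number 107) = 247"
    "ova_angular_residue (mersenne_number 13) = 271"
    by (simp_all add: ova_angular_residue_mersenne_number)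
  have "prime (3::nat)" "prime (7::nat)" "prime (31::nat)" "prime (127::nat)"
    by simp_all
  then have "prime (mersenne_number \<rho>)" if "\<rho> \<in> {2, 3, 5, 7, 107, 13}" for \<rho>
    using that prime_mersenne_13 prime_mersenne_107
    by (auto simp: mersenne_number_def simp del: prime_nat_numeral_eq)
  then show "{3, 7, 31, 127, 247, 271} \<subseteq> C_Mersenne"
    using attained[of 2] attained[of 3] attained[of 5] attained[of 7] attained[of 107] attained[of 13]
    unfolding residues by simp
qed

end
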